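(* Let $m,n,h,k$ be positive integers with $h\le n$ and $k\le m$. There exists a NASM$(m,n;h,k)$ if and only if $mh=nk$.
   Context: An $m\times n$ matrix with entries from $\{0,1,-1\}$ is a near alternating sign matrix (NASM) if the nonzero entries of each row (read left to right) and of each column (read top to bottom) alternate in sign. A NASM$(m,n;h,k)$ is an $m\times n$ NASM in which every row contains exactly $h$ nonzero entries and every column contains exactly $k$ nonzero entries. *)

theory Defs
  imports "Jordan_Normal_Form.Matrix"
begin

text \<open>Two nonzero entries are consecutive when all entries strictly between them vanish.\<close>

definition alternating_signs :: "int vec \<Rightarrow> bool" where
  "alternating_signs v \<longleftrightarrow>
     (\<forall>i j. i < j \<and> j < dim_vec v \<and> v $ i \<noteq> 0 \<and> v $ j \<noteq> 0
        \<and> (\<forall>l. i < l \<and> l < j \<longrightarrow> v $ l = 0)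
        \<longrightarrow> sgn (v $ j) = - sgn (v $ i))"

definition num_nonzero :: "int vec \<Rightarrow> nat" where
  "num_nonzero v = card {i. i < dim_vec v \<and> v $ i \<noteq> 0}"

definition near_alternating_sign_matrix :: "int mat \<Rightarrow> bool" where
  "near_alternating_sign_matrix A \<longleftrightarrow>
     elements_mat A \<subseteq> {0, 1, -1}
     \<and> (\<forall>i < dim_row A. alternating_signs (row A i))
     \<and> (\<forall>j < dim_col A. alternating_signs (col A j))"

definition NASM :: "nat \<Rightarrow> nat \<Rightarrow> nat \<Rightarrow> nat \<Rightarrow> int mat set" where
  "NASM m n h k =
     {A \<in> carrier_mat m n. near_alternating_sign_matrix A
        \<and> (\<forall>i < m. num_nonzero (row A i) = h)
        \<and> (\<forall>j < n. num_nonzero (col A j) = k)}"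

end

theory Submission
  imports Defs
begin

text \<open>
  Counting the nonzero entries by rows and by columns gives \<open>m * h = n * k\<close>. Conversely, with
  \<open>g = gcd m n\<close> this equation forces \<open>h = (n / g) * t\<close> and \<open>k = (m / g) * t\<close> for some
  \<open>1 \<le> t \<le> g\<close>. Take the biinfinite word whose support is the set of residues \<open>0, \<dots>, t - 1\<close> modulo
  \<open>g\<close>, with alternating signs along the support. The Toeplitz matrix reading off this word at
  \<open>j - i\<close> is a NASM: every row and every column is a window of the word (columns being
  reversed), and a window of length \<open>g * c\<close> meets the support in \<open>c * t\<close> places.
\<close>

text \<open>On the support, \<open>x mod g + t * (x div g)\<close> is the rank of \<open>x\<close>
  in increasing order, counted from rank 0 at the integer 0; the sign is the parity of this rank.
  Arguments are integers because \<open>j - i\<close> may be negative.\<close>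

definition alt_word :: "int \<Rightarrow> int \<Rightarrow> int \<Rightarrow> int" where
  "alt_word g t x =
     (if x mod g < t then if even (x mod g + t * (x div g)) then 1 else -1 else 0)"

lemma alt_word_eq_0_iff: "alt_word g t x = 0 \<longleftrightarrow> \<not> x mod g < t"
  by (simp add: alt_word_def)

text \<open>The hypotheses make \<open>y\<close> the successor of \<open>x\<close> in the support:
  \<open>x + 1\<close> inside a block of \<open>t\<close> residues, the next multiple of
  \<open>g\<close> at the end of a block. Either way the rank rises by one.\<close>

lemma alt_word_alternates:
  assumes t: "0 < t" "t \<le> g" and "x < y"
    and nz: "alt_word g t x \<noteq> 0" "alt_word g t y \<noteq> 0"
    and between: "\<And>z. x < z \<Longrightarrow> z < y \<Longrightarrow> alt_word g t z = 0"
  shows "alt_word g t y = - alt_word g t x"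
proof -
  define q r where "q = x div g" and "r = x mod g"
  have x: "x = g * q + r" by (simp add: q_def r_def)
  have r: "0 \<le> r" "r < t" using t nz by (auto simp: r_def alt_word_eq_0_iff)
  have divmod: "(g * p + s) mod g = s" "(g * p + s) div g = p" if "0 \<le> s" "s < g" for p s
    using that t by (auto simp: div_mult_self4[of g s p, simplified add.commute])
  show ?thesis
  proof (cases "r + 1 < t")
    case True
    have d: "(x + 1) mod g = r + 1" "(x + 1) div g = q"
      using divmod[of "r + 1" q] True r t by (simp_all add: x add.assoc)
    then have "alt_word g t (x + 1) \<noteq> 0" using True by (simp add: alt_word_eq_0_iff)
    then have "y = x + 1" using between[of "x + 1"] \<open>x < y\<close> by force
    then show ?thesis
      using True r d by (simp add: alt_word_def flip: q_def r_def)
  next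
    case False
    then have rt: "r = t - 1" using r by simp
    have d: "(g * (q + 1)) mod g = 0" "(g * (q + 1)) div g = q + 1" using t by auto
    then have "alt_word g t (g * (q + 1)) \<noteq> 0" using t by (simp only: alt_word_eq_0_iff) simp
    moreover have "x < g * (q + 1)" using x rt t by (simp add: distrib_left)
    ultimately have "y \<le> g * (q + 1)" using between[of "g * (q + 1)"] by force
    \<comment> \<open>Since \<open>x\<close> has residue \<open>t - 1\<close>, the integers strictly
      between \<open>x\<close> and the next multiple of \<open>g\<close> have residue at least
      \<open>t\<close>, off the support.\<close>
    moreover have "\<not> y < g * (q + 1)"
    proof
      assume "y < g * (q + 1)"
      then have "y mod g = y - g * q"
        using divmod(1)[of "y - g * q" q] x r \<open>x < y\<close> by (simp add: distrib_left)
      then show False using nz(2) x rt \<open>x < y\<close> by (simp add: alt_word_eq_0_iff)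
    qed
    ultimately have "y = g * (q + 1)" by simp
    then have "alt_word g t y = (if even (t * (q + 1)) then 1 else -1)"
      using d t by (simp only: alt_word_def) simp
    moreover have "alt_word g t x = (if even (r + t * q) then 1 else -1)"
      using r by (simp add: alt_word_def q_def r_def)
    \<comment> \<open>The two ranks \<open>t - 1 + t * q\<close> and \<open>t * (q + 1)\<close> are
      consecutive.\<close>
    ultimately show ?thesis by (auto simp: rt distrib_left)
  qed
qed

text \<open>Any \<open>g\<close> consecutive integers represent each residue once. The start
  \<open>a\<close> is arbitrary because rows and columns begin at varying offsets.\<close>

lemma card_residues_period:
  fixes a g t :: int
  assumes "0 < g" "t \<le> g"
  shows "card {x \<in> {a..<a + g}. x mod g < t} = nat t"
proof -
  have "bij_betw (\<lambda>x. x mod g) {x \<in> {a..<a + g}. x mod g < t} {0..<t}"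
  \<comment> \<open>The inverse picks the unique integer of the window congruent to \<open>r\<close>
    modulo \<open>g\<close>.\<close>
  proof (rule bij_betwI[where g = "\<lambda>r. a + (r - a) mod g"])
    show "(\<lambda>x. x mod g) \<in> {x \<in> {a..<a + g}. x mod g < t} \<rightarrow> {0..<t}"
      using assms by auto
    show "(\<lambda>r. a + (r - a) mod g) \<in> {0..<t} \<rightarrow> {x \<in> {a..<a + g}. x mod g < t}"
      using assms by (auto simp: mod_simps)
    show "a + (x mod g - a) mod g = x" if "x \<in> {x \<in> {a..<a + g}. x mod g < t}" for x
      using that by (simp add: mod_simps)
    show "(a + (r - a) mod g) mod g = r" if "r \<in> {0..<t}" for r
      using that assms by (simp add: mod_simps)
  qed
  then show ?thesis by (simp add: bij_betw_same_card)
qed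

lemma card_residues_window:
  fixes a g t :: int
  assumes "0 < g" "t \<le> g"
  shows "card {x \<in> {a..<a + g * int c}. x mod g < t} = c * nat t"
proof (induction c)
  case 0
  then show ?case by simp
next
  case (Suc c)
  let ?b = "a + g * int c"
  have "a \<le> ?b" using assms by simp
  moreover have "a + g * int (Suc c) = ?b + g" by (simp add: distrib_left)
  ultimately have "{a..<a + g * int (Suc c)} = {a..<?b} \<union> {?b..<?b + g}"
    using assms by (simp add: ivl_disj_un_two(3) add.assoc)
  then have "{x \<in> {a..<a + g * int (Suc c)}. x mod g < t} =
      {x \<in> {a..<?b}. x mod g < t} \<union> {x \<in> {?b..<?b + g}. x mod g < t}"
    by auto
  also have "card \<dots> = c * nat t + nat t"
    using Suc card_residues_period[OF assms, of ?b]
    by (subst card_Un_disjoint) (simp_all only: finite_Collect_conjI finite_atLeastLessThan_int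
        Collect_mem_eq simp_thms, auto)
  finally show ?case by simp
qed

definition toeplitz_nasm :: "nat \<Rightarrow> nat \<Rightarrow> int \<Rightarrow> int \<Rightarrow> int mat" where
  "toeplitz_nasm m n g t = mat m n (\<lambda>(i, j). alt_word g t (int j - int i))"

lemma near_alternating_toeplitz_nasm:
  assumes t: "0 < t" "t \<le> g"
  shows "near_alternating_sign_matrix (toeplitz_nasm m n g t)"
proof -
  let ?A = "toeplitz_nasm m n g t"
  have "elements_mat ?A \<subseteq> {0, 1, -1}"
    by (auto simp: elements_mat_def toeplitz_nasm_def alt_word_def)
  moreover have "alternating_signs (row ?A i)" if "i < dim_row ?A" for i
    unfolding alternating_signs_def
  proof (intro allI impI, elim conjE)
    fix j l
    assume *: "j < l" "l < dim_vec (row ?A i)" "row ?A i $ j \<noteq> 0" "row ?A i $ l \<noteq> 0"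
      "\<forall>p. j < p \<and> p < l \<longrightarrow> row ?A i $ p = 0"
    have entry: "row ?A i $ p = alt_word g t (int p - int i)" if "p \<le> l" for p
      using that * \<open>i < dim_row ?A\<close> by (simp add: toeplitz_nasm_def)
    have "alt_word g t (int l - int i) = - alt_word g t (int j - int i)"
    proof (rule alt_word_alternates[OF t])
      fix z assume "int j - int i < z" "z < int l - int i"
      then have "j < nat (z + int i)" "nat (z + int i) < l" "0 \<le> z + int i" by linarith+
      then show "alt_word g t z = 0"
        using * entry[of "nat (z + int i)"] by simp
    qed (use * entry in auto)
    then show "sgn (row ?A i $ l) = - sgn (row ?A i $ j)" using * entry by simp
  qed
  moreover have "alternating_signs (col ?A j)" if "j < dim_col ?A" for j
    unfolding alternating_signs_def
  proof (intro allI impI, elim conjE)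
    fix i l
    assume *: "i < l" "l < dim_vec (col ?A j)" "col ?A j $ i \<noteq> 0" "col ?A j $ l \<noteq> 0"
      "\<forall>p. i < p \<and> p < l \<longrightarrow> col ?A j $ p = 0"
    have entry: "col ?A j $ p = alt_word g t (int j - int p)" if "p \<le> l" for p
      using that * \<open>j < dim_col ?A\<close> by (simp add: toeplitz_nasm_def)
    \<comment> \<open>Going down a column decreases the argument, so the lower entry
      \<open>l\<close> comes first in the word and takes the role of \<open>x\<close>.\<close>
    have "alt_word g t (int j - int i) = - alt_word g t (int j - int l)"
    proof (rule alt_word_alternates[OF t])
      fix z assume "int j - int l < z" "z < int j - int i"
      then have "i < nat (int j - z)" "nat (int j - z) < l" "0 \<le> int j - z" by linarith+
      then show "alt_word g t z = 0"
        using * entry[of "nat (int j - z)"] by simp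
    qed (use * entry in auto)
    then show "sgn (col ?A j $ l) = - sgn (col ?A j $ i)" using * entry by simp
  qed
  ultimately show ?thesis by (simp add: near_alternating_sign_matrix_def)
qed

lemma toeplitz_nasm_in_NASM:
  assumes t: "0 < t" "t \<le> g"
  shows "toeplitz_nasm (g * c) (g * d) (int g) (int t) \<in> NASM (g * c) (g * d) (d * t) (c * t)"
proof -
  let ?A = "toeplitz_nasm (g * c) (g * d) (int g) (int t)"
  have "num_nonzero (row ?A i) = d * t" if "i < g * c" for i
  proof -
    have "bij_betw (\<lambda>j. int j - int i) {j. j < g * d \<and> (int j - int i) mod int g < int t}
        {x \<in> {- int i..<- int i + int g * int d}. x mod int g < int t}"
      by (rule bij_betwI[where g = "\<lambda>x. nat (x + int i)"])
        (auto simp: nat_less_iff simp flip: of_nat_mult)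
    moreover have "num_nonzero (row ?A i) =
        card {j. j < g * d \<and> (int j - int i) mod int g < int t}"
      unfolding num_nonzero_def using that
      by (auto simp: toeplitz_nasm_def alt_word_eq_0_iff intro!: arg_cong[where f = card])
    ultimately show ?thesis
      using card_residues_window[of "int g" "int t" "- int i" d] t
      by (simp add: bij_betw_same_card)
  qed
  moreover have "num_nonzero (col ?A j) = c * t" if "j < g * d" for j
  proof -
    \<comment> \<open>For \<open>i\<close> from 0 to \<open>g * c - 1\<close> the argument descends
      from \<open>j\<close> to \<open>j + 1 - g * c\<close>, so the half-open window starts at
      \<open>?a\<close> and stops before \<open>j + 1\<close>.\<close>
    let ?a = "int j + 1 - int g * int c"
    have "bij_betw (\<lambda>i. int j - int i) {i. i < g * c \<and> (int j - int i) mod int g < int t}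
        {x \<in> {?a..<?a + int g * int c}. x mod int g < int t}"
      by (rule bij_betwI[where g = "\<lambda>x. nat (int j - x)"])
        (auto simp: nat_less_iff simp flip: of_nat_mult)
    moreover have "num_nonzero (col ?A j) =
        card {i. i < g * c \<and> (int j - int i) mod int g < int t}"
      unfolding num_nonzero_def using that
      by (auto simp: toeplitz_nasm_def alt_word_eq_0_iff intro!: arg_cong[where f = card])
    ultimately show ?thesis
      using card_residues_window[of "int g" "int t" ?a c] t
      by (simp add: bij_betw_same_card)
  qed
  moreover have "?A \<in> carrier_mat (g * c) (g * d)" by (simp add: toeplitz_nasm_def)
  ultimately show ?thesis
    using near_alternating_toeplitz_nasm[of "int t" "int g"] t by (simp add: NASM_def)
qed

lemma NASM_double_count:
  assumes "A \<in> NASM m n h k"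
  shows "m * h = n * k"
proof -
  have A: "A \<in> carrier_mat m n" using assms by (simp add: NASM_def)
  let ?R = "\<lambda>i j. A $$ (i, j) \<noteq> 0"
  have row: "card {j \<in> {..<n}. ?R i j} = h" if "i < m" for i
  proof -
    have "num_nonzero (row A i) = card {j \<in> {..<n}. ?R i j}"
      unfolding num_nonzero_def using A that by (auto intro!: arg_cong[where f = card])
    then show ?thesis using assms that by (simp add: NASM_def)
  qed
  have col: "card {i \<in> {..<m}. ?R i j} = k" if "j < n" for j
  proof -
    have "num_nonzero (col A j) = card {i \<in> {..<m}. ?R i j}"
      unfolding num_nonzero_def using A that by (auto intro!: arg_cong[where f = card])
    then show ?thesis using assms that by (simp add: NASM_def)
  qed
  \<comment> \<open>The sum over rows is regrouped by columns, each contributing \<open>k\<close>;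
    by \<open>row\<close> it also equals \<open>m * h\<close>.\<close>
  have "(\<Sum>i<m. card {j \<in> {..<n}. ?R i j}) = k * card {..<n}"
    by (rule sum_multicount) (use col in auto)
  then show ?thesis using row by simp
qed

theorem theorem3p6:
  fixes m n h k :: nat
  assumes "0 < m" and "0 < n" and "0 < h" and "0 < k"
    and "h \<le> n" and "k \<le> m"
  shows "(\<exists>A. A \<in> NASM m n h k) \<longleftrightarrow> m * h = n * k"
proof
  assume "\<exists>A. A \<in> NASM m n h k"
  then show "m * h = n * k" using NASM_double_count by blast
next
  assume eq: "m * h = n * k"
  \<comment> \<open>The coprime cofactors \<open>c\<close> and \<open>d\<close> will be the numbers
    of periods in a column and in a row.\<close>
  obtain g c d where g: "g = gcd m n" and c: "m = g * c" and d: "n = g * d" and cop: "coprime c d"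
    using gcd_coprime_exists[of m n] assms(1) by (metis gcd_eq_0_iff mult.commute neq0_conv)
  have pos: "0 < g" "0 < c" "0 < d" using assms(1,2) c d by auto
  have eq': "c * h = d * k" using eq pos by (simp add: c d)
  \<comment> \<open>As \<open>d\<close> divides \<open>c * h\<close> and is coprime to
    \<open>c\<close>, it divides \<open>h\<close>; the quotient \<open>t\<close> is the number of
    support residues per period.\<close>
  then have "d dvd h" using cop by (metis coprime_commute coprime_dvd_mult_right_iff dvd_triv_left)
  then obtain t where h: "h = d * t" ..
  then have k: "k = c * t" using eq' pos by simp
  \<comment> \<open>Cancelling \<open>d\<close> turns \<open>h \<le> n\<close> into
    \<open>t \<le> g\<close>.\<close>
  have "0 < t" "t \<le> g" using assms(3,5) pos by (auto simp: h d)
  then show "\<exists>A. A \<in> NASM m n h k"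
    using toeplitz_nasm_in_NASM unfolding h k c d by blast
qed

end
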